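(* Let $M$ be an $\omega_1$-saturated first-order structure and let $G$ be a definably amenable group definable in $M$. Let $\mu_0$ be a left-invariant Keisler measure on $G$, let $\mathcal{B}$ be the $\sigma$-algebra of subsets of $G$ generated by the definable subsets of $G$, and let $\mu$ be the $\sigma$-additive (left-invariant) measure on $\mathcal{B}$ extending $\mu_0$. Then there exists an invariant mean on $L^{\infty}(G)=L^\infty(G,\mathcal{B},\mu)$.
   Context: "Definable" means definable in $M$ with parameters from $M$. A structure $M$ is $\omega_1$-saturated if every finitely satisfiable partial type over a countable set of parameters is realized in $M$; in particular, every countable cover of a definable set by definable sets has a finite subcover. A Keisler measure on $G$ is a finitely additive probability measure on the Boolean algebra of definable subsets of $G$; it is left-invariant if $\mu_0(gD)=\mu_0(D)$ for all $g\in G$ and all definable $D\subseteq G$. $G$ is definably amenable if it has a left-invariant Keisler measure. When $M$ is $\omega_1$-saturated, a left-invariant Keisler measure $\mu_0$ extends uniquely to a $\sigma$-additive measure $\mu$ on $\mathcal{B}$, and $\mu$ is left-invariant. $L^{\infty}(G)$ is the Banach space of essentially bounded $\mathcal{B}$-measurable real functions on $G$. For $f: G\to\mathbb{R}$ and $g\in G$, ${}_gf(h)=f(gh)$. A mean on $L^\infty(G)$ is a positive linear functional $m: L^\infty(G)\to\mathbb{R}$ with $m(\mathbf{1}_G)=1$; it is invariant if $m({}_gf)=m(f)$ for all $f\in L^\infty(G)$ and $g\in G$. *)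

theory Defs
  imports "HOL-Analysis.Analysis" "HOL-Algebra.Coset"
begin

section \<open>First-order structures\<close>

text \<open>
  The universe of a structure is the type \<open>'m\<close>.  A language is given by \<^emph>\<open>sets\<close> of function
  and relation symbols (possibly empty, of any cardinality) with arities; constant symbols are
  function symbols of arity 0.  The interpretations take argument lists, and only their values on
  lists whose length is the arity of the symbol matter.
\<close>

record ('f, 'r) language =
  funs :: "'f set"
  rels :: "'r set"
  fun_arity :: "'f \<Rightarrow> nat"
  rel_arity :: "'r \<Rightarrow> nat"

record ('f, 'r, 'm) struct =
  fun_interp :: "'f \<Rightarrow> 'm list \<Rightarrow> 'm"
  rel_interp :: "'r \<Rightarrow> 'm list \<Rightarrow> bool"

text \<open>
  Terms and formulas with parameters: \<open>Par a\<close> is the constant naming the element \<open>a\<close> of the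
  structure.
\<close>

datatype ('f, 'm) fo_term =
    Var nat
  | Par 'm
  | Fun 'f "('f, 'm) fo_term list"

datatype ('f, 'r, 'm) fo_form =
    Equal "('f, 'm) fo_term" "('f, 'm) fo_term"
  | Pred 'r "('f, 'm) fo_term list"
  | Neg "('f, 'r, 'm) fo_form"
  | Conj "('f, 'r, 'm) fo_form" "('f, 'r, 'm) fo_form"
  | Exi nat "('f, 'r, 'm) fo_form"

fun wf_term :: "('f, 'r) language \<Rightarrow> ('f, 'm) fo_term \<Rightarrow> bool" where
  "wf_term L (Var i) \<longleftrightarrow> True"
| "wf_term L (Par a) \<longleftrightarrow> True"
| "wf_term L (Fun f ts) \<longleftrightarrow>
     f \<in> funs L \<and> length ts = fun_arity L f \<and> (\<forall>t \<in> set ts. wf_term L t)"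

fun wf_form :: "('f, 'r) language \<Rightarrow> ('f, 'r, 'm) fo_form \<Rightarrow> bool" where
  "wf_form L (Equal s t) \<longleftrightarrow> wf_term L s \<and> wf_term L t"
| "wf_form L (Pred r ts) \<longleftrightarrow>
     r \<in> rels L \<and> length ts = rel_arity L r \<and> (\<forall>t \<in> set ts. wf_term L t)"
| "wf_form L (Neg \<phi>) \<longleftrightarrow> wf_form L \<phi>"
| "wf_form L (Conj \<phi> \<psi>) \<longleftrightarrow> wf_form L \<phi> \<and> wf_form L \<psi>"
| "wf_form L (Exi i \<phi>) \<longleftrightarrow> wf_form L \<phi>"

fun fv_term :: "('f, 'm) fo_term \<Rightarrow> nat set" where
  "fv_term (Var i) = {i}"
| "fv_term (Par a) = {}"
| "fv_term (Fun f ts) = (\<Union>t \<in> set ts. fv_term t)"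

fun fv_form :: "('f, 'r, 'm) fo_form \<Rightarrow> nat set" where
  "fv_form (Equal s t) = fv_term s \<union> fv_term t"
| "fv_form (Pred r ts) = (\<Union>t \<in> set ts. fv_term t)"
| "fv_form (Neg \<phi>) = fv_form \<phi>"
| "fv_form (Conj \<phi> \<psi>) = fv_form \<phi> \<union> fv_form \<psi>"
| "fv_form (Exi i \<phi>) = fv_form \<phi> - {i}"

fun par_term :: "('f, 'm) fo_term \<Rightarrow> 'm set" where
  "par_term (Var i) = {}"
| "par_term (Par a) = {a}"
| "par_term (Fun f ts) = (\<Union>t \<in> set ts. par_term t)"

fun par_form :: "('f, 'r, 'm) fo_form \<Rightarrow> 'm set" where
  "par_form (Equal s t) = par_term s \<union> par_term t"
| "par_form (Pred r ts) = (\<Union>t \<in> set ts. par_term t)"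
| "par_form (Neg \<phi>) = par_form \<phi>"
| "par_form (Conj \<phi> \<psi>) = par_form \<phi> \<union> par_form \<psi>"
| "par_form (Exi i \<phi>) = par_form \<phi>"

fun eval_term :: "('f, 'r, 'm) struct \<Rightarrow> (nat \<Rightarrow> 'm) \<Rightarrow> ('f, 'm) fo_term \<Rightarrow> 'm" where
  "eval_term M e (Var i) = e i"
| "eval_term M e (Par a) = a"
| "eval_term M e (Fun f ts) = fun_interp M f (map (eval_term M e) ts)"

fun sat :: "('f, 'r, 'm) struct \<Rightarrow> (nat \<Rightarrow> 'm) \<Rightarrow> ('f, 'r, 'm) fo_form \<Rightarrow> bool" where
  "sat M e (Equal s t) \<longleftrightarrow> eval_term M e s = eval_term M e t"
| "sat M e (Pred r ts) \<longleftrightarrow> rel_interp M r (map (eval_term M e) ts)"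
| "sat M e (Neg \<phi>) \<longleftrightarrow> \<not> sat M e \<phi>"
| "sat M e (Conj \<phi> \<psi>) \<longleftrightarrow> sat M e \<phi> \<and> sat M e \<psi>"
| "sat M e (Exi i \<phi>) \<longleftrightarrow> (\<exists>a. sat M (e(i := a)) \<phi>)"

definition formulas :: "('f, 'r) language \<Rightarrow> 'm set \<Rightarrow> nat \<Rightarrow> ('f, 'r, 'm) fo_form set" where
  "formulas L A n = {\<phi>. wf_form L \<phi> \<and> par_form \<phi> \<subseteq> A \<and> fv_form \<phi> \<subseteq> {..<n}}"

text \<open>
  The \<open>n\<close>-tuple \<open>xs\<close> is substituted for the variables \<open>0, \<dots>, n - 1\<close>; the values of
  \<open>(!) xs\<close> beyond the length of \<open>xs\<close> are irrelevant for formulas in these variables.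
\<close>

definition realizes :: "('f, 'r, 'm) struct \<Rightarrow> 'm list \<Rightarrow> ('f, 'r, 'm) fo_form \<Rightarrow> bool" where
  "realizes M xs \<phi> \<longleftrightarrow> sat M ((!) xs) \<phi>"

definition definable ::
    "('f, 'r) language \<Rightarrow> ('f, 'r, 'm) struct \<Rightarrow> nat \<Rightarrow> 'm list set \<Rightarrow> bool" where
  "definable L M n D \<longleftrightarrow>
     (\<exists>\<phi> \<in> formulas L UNIV n. D = {xs. length xs = n \<and> realizes M xs \<phi>})"

definition partial_type_over :: "('f, 'r) language \<Rightarrow> 'm set \<Rightarrow> nat \<Rightarrow> ('f, 'r, 'm) fo_form set \<Rightarrow> bool" where
  "partial_type_over L A n p \<longleftrightarrow> p \<subseteq> formulas L A n"

definition type_realized :: "('f, 'r, 'm) struct \<Rightarrow> nat \<Rightarrow> ('f, 'r, 'm) fo_form set \<Rightarrow> bool" where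
  "type_realized M n p \<longleftrightarrow> (\<exists>xs. length xs = n \<and> (\<forall>\<phi> \<in> p. realizes M xs \<phi>))"

definition omega1_saturated :: "('f, 'r) language \<Rightarrow> ('f, 'r, 'm) struct \<Rightarrow> bool" where
  "omega1_saturated L M \<longleftrightarrow>
     (\<forall>A n p. countable A \<longrightarrow> partial_type_over L A n p \<longrightarrow>
        (\<forall>q. finite q \<and> q \<subseteq> p \<longrightarrow> type_realized M n q) \<longrightarrow> type_realized M n p)"

section \<open>Definable groups and Keisler measures\<close>

text \<open>
  A group definable in \<open>M\<close>: its underlying set is a definable set of \<open>n\<close>-tuples and the graph of
  its multiplication, a set of \<open>3n\<close>-tuples, is definable.
\<close>

definition definable_group ::
    "('f, 'r) language \<Rightarrow> ('f, 'r, 'm) struct \<Rightarrow> nat \<Rightarrow> 'm list monoid \<Rightarrow> bool" where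
  "definable_group L M n G \<longleftrightarrow>
     group G \<and> definable L M n (carrier G) \<and>
     definable L M (3 * n) {x @ y @ (x \<otimes>\<^bsub>G\<^esub> y) | x y. x \<in> carrier G \<and> y \<in> carrier G}"

definition definable_subsets ::
    "('f, 'r) language \<Rightarrow> ('f, 'r, 'm) struct \<Rightarrow> nat \<Rightarrow> 'm list monoid \<Rightarrow> 'm list set set" where
  "definable_subsets L M n G = {D. D \<subseteq> carrier G \<and> definable L M n D}"

text \<open>Values of \<open>\<mu>0\<close> at sets that are not definable subsets of \<open>G\<close> play no role.\<close>

definition keisler_measure ::
    "('f, 'r) language \<Rightarrow> ('f, 'r, 'm) struct \<Rightarrow> nat \<Rightarrow> 'm list monoid \<Rightarrow> ('m list set \<Rightarrow> real) \<Rightarrow> bool"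
  where
  "keisler_measure L M n G \<mu>0 \<longleftrightarrow>
     (\<forall>D \<in> definable_subsets L M n G. 0 \<le> \<mu>0 D) \<and>
     \<mu>0 (carrier G) = 1 \<and>
     (\<forall>D \<in> definable_subsets L M n G. \<forall>E \<in> definable_subsets L M n G.
        D \<inter> E = {} \<longrightarrow> \<mu>0 (D \<union> E) = \<mu>0 D + \<mu>0 E)"

definition left_invariant_keisler_measure ::
    "('f, 'r) language \<Rightarrow> ('f, 'r, 'm) struct \<Rightarrow> nat \<Rightarrow> 'm list monoid \<Rightarrow> ('m list set \<Rightarrow> real) \<Rightarrow> bool"
  where
  "left_invariant_keisler_measure L M n G \<mu>0 \<longleftrightarrow>
     keisler_measure L M n G \<mu>0 \<and>
     (\<forall>g \<in> carrier G. \<forall>D \<in> definable_subsets L M n G. \<mu>0 (g <#\<^bsub>G\<^esub> D) = \<mu>0 D)"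

definition definably_amenable ::
    "('f, 'r) language \<Rightarrow> ('f, 'r, 'm) struct \<Rightarrow> nat \<Rightarrow> 'm list monoid \<Rightarrow> bool" where
  "definably_amenable L M n G \<longleftrightarrow> (\<exists>\<mu>0. left_invariant_keisler_measure L M n G \<mu>0)"

text \<open>
  The library type of measures is \<open>\<sigma>\<close>-additive by construction, so \<open>\<mu>\<close> is a \<open>\<sigma>\<close>-additive
  measure on the \<open>\<sigma>\<close>-algebra generated by the definable subsets of \<open>G\<close>.
\<close>

definition extends_keisler_measure ::
    "('f, 'r) language \<Rightarrow> ('f, 'r, 'm) struct \<Rightarrow> nat \<Rightarrow> 'm list monoid \<Rightarrow> ('m list set \<Rightarrow> real)
      \<Rightarrow> 'm list measure \<Rightarrow> bool" where
  "extends_keisler_measure L M n G \<mu>0 \<mu> \<longleftrightarrow>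
     space \<mu> = carrier G \<and>
     sets \<mu> = sigma_sets (carrier G) (definable_subsets L M n G) \<and>
     (\<forall>D \<in> definable_subsets L M n G. emeasure \<mu> D = ennreal (\<mu>0 D))"

section \<open>The space \<open>L\<^sup>\<infinity>\<close> and invariant means\<close>

definition ess_bounded :: "'a measure \<Rightarrow> ('a \<Rightarrow> real) set" where
  "ess_bounded \<mu> = {f \<in> borel_measurable \<mu>. \<exists>c. AE x in \<mu>. \<bar>f x\<bar> \<le> c}"

definition ae_eq :: "'a measure \<Rightarrow> (('a \<Rightarrow> real) \<times> ('a \<Rightarrow> real)) set" where
  "ae_eq \<mu> = {(f, g). f \<in> ess_bounded \<mu> \<and> g \<in> ess_bounded \<mu> \<and> (AE x in \<mu>. f x = g x)}"

lemma equiv_ae_eq: "equiv (ess_bounded \<mu>) (ae_eq \<mu>)"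
proof (rule equivI)
  show "ae_eq \<mu> \<subseteq> ess_bounded \<mu> \<times> ess_bounded \<mu>" by (auto simp: ae_eq_def)
  show "refl_on (ess_bounded \<mu>) (ae_eq \<mu>)" by (auto simp: refl_on_def ae_eq_def)
  show "sym (ae_eq \<mu>)" by (auto simp: sym_def ae_eq_def eq_commute)
  show "trans (ae_eq \<mu>)"
    by (auto simp: trans_def ae_eq_def elim: eventually_elim2)
qed

definition Linf :: "'a measure \<Rightarrow> ('a \<Rightarrow> real) set set" where
  "Linf \<mu> = ess_bounded \<mu> // ae_eq \<mu>"

definition Linf_class :: "'a measure \<Rightarrow> ('a \<Rightarrow> real) \<Rightarrow> ('a \<Rightarrow> real) set" where
  "Linf_class \<mu> f = ae_eq \<mu> `` {f}"

lemma Linf_eq_image: "Linf \<mu> = Linf_class \<mu> ` ess_bounded \<mu>"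
  by (auto simp: Linf_def Linf_class_def quotient_def)

text \<open>
  The operations and the order of \<open>L\<^sup>\<infinity>\<close> are those of representatives; \<open>m\<close> itself is a function
  of equivalence classes, and its values outside \<open>Linf \<mu>\<close> are irrelevant.
\<close>

definition mean_on_Linf :: "'a measure \<Rightarrow> (('a \<Rightarrow> real) set \<Rightarrow> real) \<Rightarrow> bool" where
  "mean_on_Linf \<mu> m \<longleftrightarrow>
     (\<forall>f \<in> ess_bounded \<mu>. \<forall>g \<in> ess_bounded \<mu>.
        m (Linf_class \<mu> (\<lambda>x. f x + g x)) = m (Linf_class \<mu> f) + m (Linf_class \<mu> g)) \<and>
     (\<forall>c. \<forall>f \<in> ess_bounded \<mu>. m (Linf_class \<mu> (\<lambda>x. c * f x)) = c * m (Linf_class \<mu> f)) \<and>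
     (\<forall>f \<in> ess_bounded \<mu>. (AE x in \<mu>. 0 \<le> f x) \<longrightarrow> 0 \<le> m (Linf_class \<mu> f)) \<and>
     m (Linf_class \<mu> (\<lambda>x. 1)) = 1"

definition left_translate :: "('a, 'b) monoid_scheme \<Rightarrow> 'a \<Rightarrow> ('a \<Rightarrow> real) \<Rightarrow> 'a \<Rightarrow> real" where
  "left_translate G g f = (\<lambda>h. f (g \<otimes>\<^bsub>G\<^esub> h))"

definition invariant_mean_on_Linf ::
    "('a, 'b) monoid_scheme \<Rightarrow> 'a measure \<Rightarrow> (('a \<Rightarrow> real) set \<Rightarrow> real) \<Rightarrow> bool" where
  "invariant_mean_on_Linf G \<mu> m \<longleftrightarrow>
     mean_on_Linf \<mu> m \<and>
     (\<forall>g \<in> carrier G. \<forall>f \<in> ess_bounded \<mu>.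
        m (Linf_class \<mu> (left_translate G g f)) = m (Linf_class \<mu> f))"

end

theory Submission
  imports Defs
begin

text \<open>
  The mean is integration against \<open>\<mu>\<close>, and everything comes down to the left invariance of \<open>\<mu>\<close>
  on the whole \<open>\<sigma>\<close>-algebra.

  The definable subsets of \<open>G\<close> are closed under intersection and generate the \<open>\<sigma>\<close>-algebra, so a
  finite measure is determined by its values on them.  The push-forward of \<open>\<mu>\<close> under a left
  translation agrees with \<open>\<mu>\<close> on definable sets because \<open>\<mu>0\<close> is invariant, hence it is \<open>\<mu>\<close>
  (\<open>distr_left_mult\<close>).  For this argument a translate of a definable set must again be definable
  (\<open>definable_l_coset\<close>): \<open>z \<in> g D\<close> says that some \<open>x\<close> satisfies both \<open>x \<in> D\<close> and
  \<open>(g, x, z) \<in> \<Gamma>\<close>, where \<open>\<Gamma>\<close> is the graph of multiplication.  Writing this as a formula requires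
  substituting parameters and other variables into the formulas that define \<open>D\<close> and \<open>\<Gamma>\<close>; the
  existence of capture-avoiding substitutions is \<open>ex_subst_form\<close>.

  Since \<open>\<mu>\<close> is finite, essentially bounded functions are integrable, and their integral depends
  only on their class, so \<open>f \<mapsto> \<integral> f d\<mu>\<close> is a mean on \<open>L\<^sup>\<infinity>\<close>; it is invariant because \<open>\<mu>\<close> is.
\<close>

section \<open>Substitution in first-order formulas\<close>

lemma finite_fv_term: "finite (fv_term t)"
  by (induction t) auto

lemma finite_fv_form: "finite (fv_form \<phi>)"
  by (induction \<phi>) (auto simp: finite_fv_term)

lemma eval_term_cong: "(\<And>i. i \<in> fv_term t \<Longrightarrow> e i = e' i) \<Longrightarrow> eval_term M e t = eval_term M e' t"
proof (induction t)
  case (Fun f ts)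
  then have "map (eval_term M e) ts = map (eval_term M e') ts" by auto
  then show ?case by (simp only: eval_term.simps)
qed auto

lemma sat_cong: "(\<And>i. i \<in> fv_form \<phi> \<Longrightarrow> e i = e' i) \<Longrightarrow> sat M e \<phi> \<longleftrightarrow> sat M e' \<phi>"
proof (induction \<phi> arbitrary: e e')
  case (Equal s t)
  then show ?case using eval_term_cong[of s e e' M] eval_term_cong[of t e e' M] by auto
next
  case (Pred r ts)
  then have "map (eval_term M e) ts = map (eval_term M e') ts"
    by (auto intro!: eval_term_cong)
  then show ?case by (simp only: sat.simps)
next
  case (Neg \<phi>)
  from Neg.IH[of e e'] Neg.prems show ?case by simp
next
  case (Conj \<phi> \<psi>)
  from Conj.IH(1)[of e e'] Conj.IH(2)[of e e'] Conj.prems show ?case by simp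
next
  case (Exi i \<phi>)
  have "sat M (e(i := a)) \<phi> \<longleftrightarrow> sat M (e'(i := a)) \<phi>" for a
    by (rule Exi.IH) (use Exi.prems in auto)
  then show ?case by simp
qed

fun subst_term :: "(nat \<Rightarrow> ('f, 'm) fo_term) \<Rightarrow> ('f, 'm) fo_term \<Rightarrow> ('f, 'm) fo_term" where
  "subst_term \<sigma> (Var i) = \<sigma> i"
| "subst_term \<sigma> (Par a) = Par a"
| "subst_term \<sigma> (Fun f ts) = Fun f (map (subst_term \<sigma>) ts)"

lemma wf_subst_term:
  "wf_term L t \<Longrightarrow> (\<And>i. i \<in> fv_term t \<Longrightarrow> wf_term L (\<sigma> i)) \<Longrightarrow> wf_term L (subst_term \<sigma> t)"
  by (induction t) auto

lemma fv_subst_term: "fv_term (subst_term \<sigma> t) = (\<Union>i \<in> fv_term t. fv_term (\<sigma> i))"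
  by (induction t) auto

lemma eval_subst_term:
  "eval_term M e (subst_term \<sigma> t) = eval_term M (\<lambda>i. eval_term M e (\<sigma> i)) t"
proof (induction t)
  case (Fun f ts)
  then have "map (eval_term M e \<circ> subst_term \<sigma>) ts
      = map (eval_term M (\<lambda>i. eval_term M e (\<sigma> i))) ts"
    by auto
  then show ?case by (simp only: subst_term.simps eval_term.simps map_map)
qed auto

text \<open>
  The substituted formula is asserted to exist, not computed by a function: under a quantifier
  the bound variable has to be renamed to one that does not occur in the substituted terms, and
  which fresh variable is taken does not matter.
\<close>

lemma ex_subst_form:
  assumes "wf_form L \<phi>" and "\<And>i. i \<in> fv_form \<phi> \<Longrightarrow> wf_term L (\<sigma> i)"
  shows "\<exists>\<psi>. wf_form L \<psi> \<and> fv_form \<psi> \<subseteq> (\<Union>i \<in> fv_form \<phi>. fv_term (\<sigma> i)) \<and>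
           (\<forall>e. sat M e \<psi> \<longleftrightarrow> sat M (\<lambda>i. eval_term M e (\<sigma> i)) \<phi>)"
  using assms
proof (induction \<phi> arbitrary: \<sigma>)
  case (Equal s t)
  then show ?case
    by (intro exI[of _ "Equal (subst_term \<sigma> s) (subst_term \<sigma> t)"])
       (auto simp: wf_subst_term fv_subst_term eval_subst_term)
next
  case (Pred r ts)
  have "map (eval_term M e \<circ> subst_term \<sigma>) ts
      = map (eval_term M (\<lambda>i. eval_term M e (\<sigma> i))) ts" for e
    by (simp add: eval_subst_term)
  then have sat: "sat M e (Pred r (map (subst_term \<sigma>) ts))
      \<longleftrightarrow> sat M (\<lambda>i. eval_term M e (\<sigma> i)) (Pred r ts)" for e
    by (simp only: sat.simps map_map)
  have wf: "wf_term L (subst_term \<sigma> t)" if "t \<in> set ts" for t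
    by (rule wf_subst_term) (use Pred.prems that in auto)
  show ?case
  proof (intro exI[of _ "Pred r (map (subst_term \<sigma>) ts)"] conjI allI sat)
    show "wf_form L (Pred r (map (subst_term \<sigma>) ts))"
      using Pred.prems(1) wf by simp
  qed (auto simp: fv_subst_term)
next
  case (Neg \<phi>)
  obtain \<psi> where "wf_form L \<psi>" "fv_form \<psi> \<subseteq> (\<Union>i \<in> fv_form \<phi>. fv_term (\<sigma> i))"
    "\<forall>e. sat M e \<psi> \<longleftrightarrow> sat M (\<lambda>i. eval_term M e (\<sigma> i)) \<phi>"
    using Neg.IH[of \<sigma>] Neg.prems by auto
  then show ?case by (intro exI[of _ "Neg \<psi>"]) simp
next
  case (Conj \<phi> \<phi>')
  obtain \<psi> where \<psi>: "wf_form L \<psi>" "fv_form \<psi> \<subseteq> (\<Union>i \<in> fv_form \<phi>. fv_term (\<sigma> i))"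
    "\<forall>e. sat M e \<psi> \<longleftrightarrow> sat M (\<lambda>i. eval_term M e (\<sigma> i)) \<phi>"
    using Conj.IH(1)[of \<sigma>] Conj.prems by auto
  obtain \<psi>' where \<psi>': "wf_form L \<psi>'" "fv_form \<psi>' \<subseteq> (\<Union>i \<in> fv_form \<phi>'. fv_term (\<sigma> i))"
    "\<forall>e. sat M e \<psi>' \<longleftrightarrow> sat M (\<lambda>i. eval_term M e (\<sigma> i)) \<phi>'"
    using Conj.IH(2)[of \<sigma>] Conj.prems by auto
  show ?case
    by (rule exI[of _ "Conj \<psi> \<psi>'"]) (use \<psi> \<psi>' in auto)
next
  case (Exi i \<phi>)
  define V where "V = (\<Union>j \<in> fv_form \<phi> - {i}. fv_term (\<sigma> j))"
  have "finite V" by (simp add: V_def finite_fv_form finite_fv_term)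
  then obtain k where k: "k \<notin> V" using ex_new_if_finite[OF infinite_UNIV_nat] by blast
  define \<sigma>' where "\<sigma>' = \<sigma>(i := Var k)"
  have "\<exists>\<psi>. wf_form L \<psi> \<and> fv_form \<psi> \<subseteq> (\<Union>j \<in> fv_form \<phi>. fv_term (\<sigma>' j)) \<and>
      (\<forall>e. sat M e \<psi> \<longleftrightarrow> sat M (\<lambda>j. eval_term M e (\<sigma>' j)) \<phi>)"
    by (rule Exi.IH) (use Exi.prems in \<open>auto simp: \<sigma>'_def\<close>)
  then obtain \<psi> where \<psi>: "wf_form L \<psi>" "fv_form \<psi> \<subseteq> (\<Union>j \<in> fv_form \<phi>. fv_term (\<sigma>' j))"
    "\<And>e. sat M e \<psi> \<longleftrightarrow> sat M (\<lambda>j. eval_term M e (\<sigma>' j)) \<phi>"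
    by blast
  have sat: "sat M (e(k := a)) \<psi> \<longleftrightarrow> sat M ((\<lambda>j. eval_term M e (\<sigma> j))(i := a)) \<phi>" for e a
    unfolding \<psi>(3)
  proof (rule sat_cong)
    fix j assume j: "j \<in> fv_form \<phi>"
    show "eval_term M (e(k := a)) (\<sigma>' j) = ((\<lambda>j. eval_term M e (\<sigma> j))(i := a)) j"
    proof (cases "j = i")
      case False
      with j k have "k \<notin> fv_term (\<sigma> j)" by (auto simp: V_def)
      with False show ?thesis by (auto simp: \<sigma>'_def intro!: eval_term_cong)
    qed (simp add: \<sigma>'_def)
  qed
  have "fv_form \<psi> - {k} \<subseteq> V"
    using \<psi>(2) by (auto simp: \<sigma>'_def V_def split: if_splits)
  with \<psi>(1) sat show ?case
    by (intro exI[of _ "Exi k \<psi>"]) (simp add: V_def)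
qed

section \<open>Closure properties of definable sets\<close>

lemma definable_length: "definable L M n D \<Longrightarrow> xs \<in> D \<Longrightarrow> length xs = n"
  by (auto simp: definable_def)

lemma definable_Int:
  assumes "definable L M n D" "definable L M n E"
  shows "definable L M n (D \<inter> E)"
proof -
  obtain \<phi> where \<phi>: "\<phi> \<in> formulas L UNIV n" "D = {xs. length xs = n \<and> realizes M xs \<phi>}"
    using assms(1) by (auto simp: definable_def)
  obtain \<psi> where \<psi>: "\<psi> \<in> formulas L UNIV n" "E = {xs. length xs = n \<and> realizes M xs \<psi>}"
    using assms(2) by (auto simp: definable_def)
  show ?thesis unfolding definable_def
    by (rule bexI[of _ "Conj \<phi> \<psi>"]) (use \<phi> \<psi> in \<open>auto simp: formulas_def realizes_def\<close>)
qed

text \<open>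
  With variables and parameters for \<open>ts\<close>, this covers permutations and repetitions of
  coordinates, cylinders and fibres of definable sets.
\<close>

lemma definable_term_preimage:
  assumes "definable L M k D" and "length ts = k"
    and ts: "\<And>t. t \<in> set ts \<Longrightarrow> wf_term L t \<and> fv_term t \<subseteq> {..<n}"
  shows "definable L M n {xs. length xs = n \<and> map (eval_term M ((!) xs)) ts \<in> D}"
proof -
  obtain \<phi> where \<phi>: "wf_form L \<phi>" "fv_form \<phi> \<subseteq> {..<k}"
      and D: "D = {xs. length xs = k \<and> realizes M xs \<phi>}"
    using assms(1) by (auto simp: definable_def formulas_def)
  have nth: "wf_term L (ts ! i) \<and> fv_term (ts ! i) \<subseteq> {..<n}" if "i \<in> fv_form \<phi>" for i
    using that \<phi>(2) ts assms(2) by (meson lessThan_iff nth_mem subsetD)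
  obtain \<psi> where \<psi>: "wf_form L \<psi>" "fv_form \<psi> \<subseteq> (\<Union>i \<in> fv_form \<phi>. fv_term (ts ! i))"
    "\<And>e. sat M e \<psi> \<longleftrightarrow> sat M (\<lambda>i. eval_term M e (ts ! i)) \<phi>"
    using ex_subst_form[OF \<phi>(1), of "(!) ts" M] nth by blast
  have "sat M ((!) xs) \<psi> \<longleftrightarrow> sat M ((!) (map (eval_term M ((!) xs)) ts)) \<phi>" for xs
    unfolding \<psi>(3) by (rule sat_cong) (use \<phi>(2) assms(2) in auto)
  moreover have "\<psi> \<in> formulas L UNIV n"
    using \<psi>(1,2) nth by (fastforce simp: formulas_def)
  ultimately show ?thesis
    unfolding definable_def D by (intro bexI[of _ \<psi>]) (auto simp: assms(2) realizes_def)
qed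

lemma definable_proj1:
  assumes "definable L M (Suc n) D"
  shows "definable L M n {xs. \<exists>y. xs @ [y] \<in> D}"
proof -
  obtain \<phi> where \<phi>: "wf_form L \<phi>" "fv_form \<phi> \<subseteq> {..<Suc n}"
      and D: "D = {xs. length xs = Suc n \<and> realizes M xs \<phi>}"
    using assms by (auto simp: definable_def formulas_def)
  have "sat M (((!) xs)(n := y)) \<phi> \<longleftrightarrow> sat M ((!) (xs @ [y])) \<phi>" if "length xs = n" for xs y
    by (rule sat_cong) (use \<phi>(2) that in \<open>auto simp: nth_append less_Suc_eq\<close>)
  moreover have "Exi n \<phi> \<in> formulas L UNIV n"
    using \<phi> by (auto simp: formulas_def less_Suc_eq)
  ultimately show ?thesis
    unfolding definable_def D by (intro bexI[of _ "Exi n \<phi>"]) (auto simp: realizes_def)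
qed

lemma definable_proj:
  assumes "definable L M (n + k) D"
  shows "definable L M n {xs. \<exists>ys. length ys = k \<and> xs @ ys \<in> D}"
  using assms
proof (induction k arbitrary: D)
  case 0
  then show ?case by simp
next
  case (Suc k)
  have "definable L M (n + k) {xs. \<exists>y. xs @ [y] \<in> D}"
    using Suc.prems by (intro definable_proj1) simp
  note Suc.IH[OF this]
  moreover have "(\<exists>ys. length ys = k \<and> (\<exists>y. (xs @ ys) @ [y] \<in> D))
      \<longleftrightarrow> (\<exists>ys. length ys = Suc k \<and> xs @ ys \<in> D)" for xs
    by (metis append.assoc length_append_singleton length_Suc_conv_rev)
  ultimately show ?case by simp
qed

section \<open>Translates of definable sets\<close>

lemma definable_l_coset:
  fixes L :: "('f, 'r) language" and M :: "('f, 'r, 'm) struct"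
  assumes G: "definable_group L M n G" and g: "g \<in> carrier G"
    and D: "D \<in> definable_subsets L M n G"
  shows "g <#\<^bsub>G\<^esub> D \<in> definable_subsets L M n G"
proof -
  interpret group G using G by (simp add: definable_group_def)
  define \<Gamma> where "\<Gamma> = {x @ y @ (x \<otimes>\<^bsub>G\<^esub> y) | x y. x \<in> carrier G \<and> y \<in> carrier G}"
  have def_carrier: "definable L M n (carrier G)" and def_\<Gamma>: "definable L M (3 * n) \<Gamma>"
    using G by (auto simp: definable_group_def \<Gamma>_def)
  have def_D: "definable L M n D" and sub: "D \<subseteq> carrier G"
    using D by (auto simp: definable_subsets_def)
  have len: "length x = n" if "x \<in> carrier G" for x
    using definable_length[OF def_carrier that] .
  have graph: "g @ x @ z \<in> \<Gamma> \<longleftrightarrow> x \<in> carrier G \<and> z = g \<otimes>\<^bsub>G\<^esub> x" if "length x = n" for x z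
    using that g by (auto simp: \<Gamma>_def len)
  \<comment> \<open>The sets \<open>P\<close> and \<open>Q\<close> consist of \<open>2n\<close>-tuples \<open>z @ x\<close>: the quantified block \<open>x\<close> comes last
    so that it can be projected away.\<close>
  define ts :: "('f, 'm) fo_term list"
    where "ts = map Par g @ map Var [n..<n + n] @ map Var [0..<n]"
  define P where "P = {w. length w = n + n \<and> map (eval_term M ((!) w)) ts \<in> \<Gamma>}"
  define Q where
    "Q = {w. length w = n + n \<and> map (eval_term M ((!) w)) (map Var [n..<n + n]) \<in> D}"
  have "definable L M (n + n) P"
    unfolding P_def
    by (rule definable_term_preimage[OF def_\<Gamma>]) (auto simp: ts_def len[OF g])
  moreover have "definable L M (n + n) Q"
    unfolding Q_def by (rule definable_term_preimage[OF def_D]) auto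
  ultimately have "definable L M n {z. \<exists>x. length x = n \<and> z @ x \<in> P \<inter> Q}"
    by (intro definable_proj definable_Int)
  moreover have "{z. \<exists>x. length x = n \<and> z @ x \<in> P \<inter> Q} = g <#\<^bsub>G\<^esub> D"
  proof -
    have *: "map (eval_term M ((!) (z @ x))) (map Var [n..<n + n]) = x"
      "map (eval_term M ((!) (z @ x))) ts = g @ x @ z"
      if "length z = n" "length x = n" for z x
      using that by (auto simp: ts_def nth_append o_def intro!: nth_equalityI)
    have "(\<exists>x. length x = n \<and> z @ x \<in> P \<inter> Q) \<longleftrightarrow> (\<exists>x \<in> D. z = g \<otimes>\<^bsub>G\<^esub> x)" for z
    proof
      assume "\<exists>x. length x = n \<and> z @ x \<in> P \<inter> Q"
      then obtain x where x: "length x = n" "z @ x \<in> P" "z @ x \<in> Q" by blast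
      then have "length z = n" by (simp add: P_def)
      with x * graph show "\<exists>x \<in> D. z = g \<otimes>\<^bsub>G\<^esub> x" unfolding P_def Q_def by auto
    next
      assume "\<exists>x \<in> D. z = g \<otimes>\<^bsub>G\<^esub> x"
      then obtain x where x: "x \<in> D" "z = g \<otimes>\<^bsub>G\<^esub> x" by blast
      then have l: "length x = n" "length z = n" using sub g len by auto
      have "z @ x \<in> P \<inter> Q"
        unfolding P_def Q_def Int_iff mem_Collect_eq *[OF l(2,1)]
        using x sub l graph by auto
      with l show "\<exists>x. length x = n \<and> z @ x \<in> P \<inter> Q" by blast
    qed
    then show ?thesis by (auto simp: l_coset_def)
  qed
  ultimately show ?thesis
    using l_coset_subset_G[OF sub g] by (simp add: definable_subsets_def)
qed

section \<open>Left invariance of the extended measure\<close>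

lemma (in group) l_coset_inv_eq_vimage:
  assumes "g \<in> carrier G" "D \<subseteq> carrier G"
  shows "(inv g) <# D = (\<lambda>h. g \<otimes> h) -` D \<inter> carrier G"
proof (intro equalityI subsetI)
  fix h assume "h \<in> (\<lambda>h. g \<otimes> h) -` D \<inter> carrier G"
  with assms have "h = inv g \<otimes> (g \<otimes> h)" "g \<otimes> h \<in> D" by (auto simp: inv_solve_left)
  then show "h \<in> (inv g) <# D" unfolding l_coset_def by blast
next
  fix h assume "h \<in> (inv g) <# D"
  then obtain d where "d \<in> D" "h = inv g \<otimes> d" unfolding l_coset_def by blast
  moreover from this assms have "g \<otimes> h = d" by (auto simp: m_assoc[symmetric])
  ultimately show "h \<in> (\<lambda>h. g \<otimes> h) -` D \<inter> carrier G" using assms by auto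
qed

locale left_invariant_extension =
  fixes L :: "('f, 'r) language"
    and M :: "('f, 'r, 'm) struct"
    and n :: nat
    and G :: "'m list monoid" (structure)
    and \<mu>0 :: "'m list set \<Rightarrow> real"
    and \<mu> :: "'m list measure"
  assumes definable_group: "definable_group L M n G"
    and left_invariant: "left_invariant_keisler_measure L M n G \<mu>0"
    and extends: "extends_keisler_measure L M n G \<mu>0 \<mu>"
begin

abbreviation "\<D> \<equiv> definable_subsets L M n G"

sublocale group G
  using definable_group by (simp add: definable_group_def)

lemma space_eq: "space \<mu> = carrier G"
  and sets_eq: "sets \<mu> = sigma_sets (carrier G) \<D>"
  and emeasure_definable: "D \<in> \<D> \<Longrightarrow> emeasure \<mu> D = ennreal (\<mu>0 D)"
  using extends by (auto simp: extends_keisler_measure_def)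

lemma carrier_definable: "carrier G \<in> \<D>"
  using definable_group by (simp add: definable_subsets_def definable_group_def)

lemma emeasure_carrier: "emeasure \<mu> (carrier G) = 1"
  using left_invariant
  by (simp add: emeasure_definable carrier_definable left_invariant_keisler_measure_def
      keisler_measure_def)

sublocale finite_measure \<mu>
  by standard (simp add: space_eq emeasure_carrier)

lemma measure_space_eq_1: "measure \<mu> (space \<mu>) = 1"
  by (simp add: measure_def space_eq emeasure_carrier)

lemma definable_vimage:
  assumes "g \<in> carrier G" "D \<in> \<D>"
  shows "(\<lambda>h. g \<otimes> h) -` D \<inter> carrier G \<in> \<D>"
    and "\<mu>0 ((\<lambda>h. g \<otimes> h) -` D \<inter> carrier G) = \<mu>0 D"
proof -
  have sub: "D \<subseteq> carrier G" using assms by (simp add: definable_subsets_def)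
  note eq = l_coset_inv_eq_vimage[OF assms(1) sub, symmetric]
  show "(\<lambda>h. g \<otimes> h) -` D \<inter> carrier G \<in> \<D>"
    unfolding eq by (rule definable_l_coset[OF definable_group]) (use assms in auto)
  show "\<mu>0 ((\<lambda>h. g \<otimes> h) -` D \<inter> carrier G) = \<mu>0 D"
    unfolding eq using left_invariant assms by (simp add: left_invariant_keisler_measure_def)
qed

lemma measurable_left_mult:
  assumes g: "g \<in> carrier G"
  shows "(\<lambda>h. g \<otimes> h) \<in> measurable \<mu> \<mu>"
proof (rule measurable_sigma_sets[OF sets_eq])
  show "\<D> \<subseteq> Pow (carrier G)" by (auto simp: definable_subsets_def)
  show "(\<lambda>h. g \<otimes> h) \<in> space \<mu> \<rightarrow> carrier G" using g by (auto simp: space_eq)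
  fix D assume "D \<in> \<D>"
  then show "(\<lambda>h. g \<otimes> h) -` D \<inter> space \<mu> \<in> sets \<mu>"
    using definable_vimage(1)[OF g] by (simp add: space_eq sets_eq)
qed

lemma distr_left_mult:
  assumes g: "g \<in> carrier G"
  shows "distr \<mu> \<mu> (\<lambda>h. g \<otimes> h) = \<mu>"
proof (rule measure_eqI_generator_eq[where E = \<D> and \<Omega> = "carrier G" and A = "\<lambda>_. carrier G"])
  show "Int_stable \<D>"
    by (auto simp: Int_stable_def definable_subsets_def definable_Int)
  show "\<D> \<subseteq> Pow (carrier G)" by (auto simp: definable_subsets_def)
  show "emeasure (distr \<mu> \<mu> (\<lambda>h. g \<otimes> h)) D = emeasure \<mu> D" if "D \<in> \<D>" for D
  proof -
    have "D \<in> sets \<mu>" using that by (auto simp: sets_eq)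
    then show ?thesis
      by (simp add: emeasure_distr measurable_left_mult g space_eq emeasure_definable
          definable_vimage that)
  qed
  show "emeasure (distr \<mu> \<mu> (\<lambda>h. g \<otimes> h)) (carrier G) \<noteq> \<infinity>"
    using emeasure_carrier carrier_definable
    by (simp add: emeasure_distr measurable_left_mult g space_eq emeasure_definable
          definable_vimage sets_eq)
qed (use carrier_definable in \<open>auto simp: sets_eq\<close>)

end

section \<open>Integration as a mean\<close>

lemma ess_bounded_measurable: "f \<in> ess_bounded \<mu> \<Longrightarrow> f \<in> borel_measurable \<mu>"
  by (simp add: ess_bounded_def)

lemma (in finite_measure) integrable_ess_bounded: "f \<in> ess_bounded M \<Longrightarrow> integrable M f"
  unfolding ess_bounded_def by (auto intro: integrable_const_bound simp flip: real_norm_def)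

lemma ess_bounded_const: "(\<lambda>_. c) \<in> ess_bounded \<mu>"
  by (auto simp: ess_bounded_def)

lemma ess_bounded_add:
  assumes "f \<in> ess_bounded \<mu>" "g \<in> ess_bounded \<mu>"
  shows "(\<lambda>x. f x + g x) \<in> ess_bounded \<mu>"
proof -
  obtain c d where "AE x in \<mu>. \<bar>f x\<bar> \<le> c" "AE x in \<mu>. \<bar>g x\<bar> \<le> d"
    using assms by (auto simp: ess_bounded_def)
  then have "AE x in \<mu>. \<bar>f x + g x\<bar> \<le> c + d" by eventually_elim linarith
  then show ?thesis using assms by (auto simp: ess_bounded_def)
qed

lemma ess_bounded_mult:
  assumes "f \<in> ess_bounded \<mu>"
  shows "(\<lambda>x. c * f x) \<in> ess_bounded \<mu>"
proof -
  obtain d where "AE x in \<mu>. \<bar>f x\<bar> \<le> d"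
    using assms by (auto simp: ess_bounded_def)
  then have "AE x in \<mu>. \<bar>c * f x\<bar> \<le> \<bar>c\<bar> * d"
    by eventually_elim (simp add: abs_mult mult_left_mono)
  then show ?thesis using assms by (auto simp: ess_bounded_def)
qed

lemma ess_bounded_compose:
  assumes f: "f \<in> ess_bounded \<mu>" and T: "T \<in> measurable \<mu> \<mu>" and inv: "distr \<mu> \<mu> T = \<mu>"
  shows "(\<lambda>x. f (T x)) \<in> ess_bounded \<mu>"
proof -
  have [measurable]: "f \<in> borel_measurable \<mu>" "T \<in> measurable \<mu> \<mu>"
    using f T by (auto simp: ess_bounded_def)
  obtain c where "AE x in \<mu>. \<bar>f x\<bar> \<le> c"
    using f by (auto simp: ess_bounded_def)
  then have "AE x in distr \<mu> \<mu> T. \<bar>f x\<bar> \<le> c" by (simp only: inv)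
  then have "AE x in \<mu>. \<bar>f (T x)\<bar> \<le> c" by (subst (asm) AE_distr_iff) auto
  then show ?thesis by (auto simp: ess_bounded_def)
qed

text \<open>Any choice of representative gives the same integral, by \<open>integral_Linf_class\<close>.\<close>

definition Linf_integral :: "'a measure \<Rightarrow> ('a \<Rightarrow> real) set \<Rightarrow> real" where
  "Linf_integral \<mu> C = (LINT x|\<mu>. (SOME f. f \<in> C) x)"

lemma integral_Linf_class:
  assumes f: "f \<in> ess_bounded \<mu>"
  shows "Linf_integral \<mu> (Linf_class \<mu> f) = (LINT x|\<mu>. f x)"
proof -
  define h where "h = (SOME h. h \<in> Linf_class \<mu> f)"
  have "f \<in> Linf_class \<mu> f" using f by (auto simp: Linf_class_def ae_eq_def)
  then have "h \<in> Linf_class \<mu> f"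
    unfolding h_def by (rule someI[of "\<lambda>h. h \<in> Linf_class \<mu> f"])
  then have h: "h \<in> ess_bounded \<mu>" "AE x in \<mu>. f x = h x"
    by (auto simp: Linf_class_def ae_eq_def)
  have "(LINT x|\<mu>. h x) = (LINT x|\<mu>. f x)"
    using h f by (intro integral_cong_AE) (auto simp: ess_bounded_measurable)
  then show ?thesis
    by (simp add: Linf_integral_def h_def)
qed

lemma (in finite_measure) mean_Linf_integral:
  assumes "measure M (space M) = 1"
  shows "mean_on_Linf M (Linf_integral M)"
  using assms unfolding mean_on_Linf_def
  by (auto simp: integral_Linf_class ess_bounded_add ess_bounded_mult ess_bounded_const
      integrable_ess_bounded intro!: integral_nonneg_AE)

theorem theorem3p2:
  fixes L :: "('f, 'r) language"
    and M :: "('f, 'r, 'm) struct"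
    and n :: nat
    and G :: "'m list monoid"
    and \<mu>0 :: "'m list set \<Rightarrow> real"
    and \<mu> :: "'m list measure"
  assumes "omega1_saturated L M"
    and "definable_group L M n G"
    and "definably_amenable L M n G"
    and "left_invariant_keisler_measure L M n G \<mu>0"
    and "extends_keisler_measure L M n G \<mu>0 \<mu>"
  shows "\<exists>m. invariant_mean_on_Linf G \<mu> m"
proof -
  interpret left_invariant_extension L M n G \<mu>0 \<mu>
    by standard (use assms in auto)
  have "Linf_integral \<mu> (Linf_class \<mu> (left_translate G g f)) = Linf_integral \<mu> (Linf_class \<mu> f)"
    if g: "g \<in> carrier G" and f: "f \<in> ess_bounded \<mu>" for g f
  proof -
    note T = measurable_left_mult[OF g] and inv = distr_left_mult[OF g]
    have "Linf_integral \<mu> (Linf_class \<mu> (left_translate G g f)) = (LINT h|\<mu>. f (g \<otimes>\<^bsub>G\<^esub> h))"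
      unfolding left_translate_def
      by (rule integral_Linf_class[OF ess_bounded_compose[OF f T inv]])
    also have "\<dots> = (LINT h|distr \<mu> \<mu> (\<lambda>h. g \<otimes>\<^bsub>G\<^esub> h). f h)"
      by (rule integral_distr[OF T ess_bounded_measurable[OF f], symmetric])
    also have "\<dots> = Linf_integral \<mu> (Linf_class \<mu> f)"
      by (simp add: inv integral_Linf_class f)
    finally show ?thesis .
  qed
  then show ?thesis
    unfolding invariant_mean_on_Linf_def
    using mean_Linf_integral[OF measure_space_eq_1] by blast
qed

end
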